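(* Let $q\ge5$ be a prime power. Then $\Lambda_{\mathrm{Un}\Gamma,3_{\mathcal C}}=3(q-2)$, $\Pi_{3_{\mathcal C},\mathrm{Un}\Gamma}=(q-2)/2$, $\Lambda_{\mathrm{Un}\Gamma,\overline{1_{\mathcal C}}}=q$, and $\Pi_{\overline{1_{\mathcal C}},\mathrm{Un}\Gamma}=q/2$.
   Context: Let $\mathrm{PG}(3,q)$ have points $\mathbf{P}(x_0,x_1,x_2,x_3)$; put $P(t)=\mathbf{P}(t^3,t^2,t,1)$ ($t\in\mathbb{F}_q$), $P(\infty)=\mathbf{P}(1,0,0,0)$, $\mathcal{C}=\{P(t):t\in\mathbb{F}_q\cup\{\infty\}\}$ the twisted cubic, $G_q$ the group of projectivities fixing $\mathcal C$. The $\Gamma$-planes are the osculating planes $c_0x_0+\dots+c_3x_3=0$ with $(c_0,c_1,c_2,c_3)=(1,-3t,3t^2,-t^3)$, $t\in\mathbb{F}_q$, or $(0,0,0,1)$. A $3_{\mathcal C}$-plane contains exactly $3$ points of $\mathcal C$; a $\overline{1_{\mathcal C}}$-plane is a non-$\Gamma$-plane containing exactly one point of $\mathcal C$ (for $q\ge5$ each type is a $G_q$-orbit). A Un$\Gamma$-line is a line meeting $\mathcal C$ in exactly one point and lying in no $\Gamma$-plane. Notation: $\Lambda_{\lambda,\pi}$ is the number of $\lambda$-lines in a $\pi$-plane; $\Pi_{\pi,\lambda}$ is the average, over all $\lambda$-lines, of the number of $\pi$-planes through the line. *)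

theory Defs
  imports "HOL-Analysis.Analysis"
begin

text \<open>
  The projective space of dimension 3 over a finite field \<open>'a\<close> is modelled by the linear
  subspaces of \<open>'a ^ 4\<close>, with inclusion as incidence.  The coordinates
  \<open>x\<^sub>0, x\<^sub>1, x\<^sub>2, x\<^sub>3\<close> are the components \<open>x $ 1, x $ 2, x $ 3, x $ 4\<close>.
\<close>

definition pg_lines :: "('a::field ^ 4) set set" where
  "pg_lines = {l. vec.subspace l \<and> vec.dim l = 2}"

definition pg_planes :: "('a::field ^ 4) set set" where
  "pg_planes = {p. vec.subspace p \<and> vec.dim p = 3}"

definition pg_point :: "'a::field ^ 4 \<Rightarrow> ('a ^ 4) set" where
  "pg_point x = vec.span {x}"

definition hyperplane_of :: "'a::field ^ 4 \<Rightarrow> ('a ^ 4) set" where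
  "hyperplane_of c = {x. (\<Sum>i\<in>UNIV. c $ i * x $ i) = 0}"

definition twisted_cubic :: "('a::field ^ 4) set set" where
  "twisted_cubic =
     insert (pg_point (vector [1, 0, 0, 0])) (range (\<lambda>t. pg_point (vector [t ^ 3, t ^ 2, t, 1])))"

definition Gamma_planes :: "('a::field ^ 4) set set" where
  "Gamma_planes =
     insert (hyperplane_of (vector [0, 0, 0, 1]))
       (range (\<lambda>t. hyperplane_of (vector [1, - 3 * t, 3 * t ^ 2, - (t ^ 3)])))"

definition cubic_points_on :: "('a::field ^ 4) set \<Rightarrow> ('a ^ 4) set set" where
  "cubic_points_on S = {P \<in> twisted_cubic. P \<subseteq> S}"

definition three_C_planes :: "('a::field ^ 4) set set" where
  "three_C_planes = {p \<in> pg_planes. card (cubic_points_on p) = 3}"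

definition one_C_bar_planes :: "('a::field ^ 4) set set" where
  "one_C_bar_planes = {p \<in> pg_planes. p \<notin> Gamma_planes \<and> card (cubic_points_on p) = 1}"

definition UnGamma_lines :: "('a::field ^ 4) set set" where
  "UnGamma_lines =
     {l \<in> pg_lines. card (cubic_points_on l) = 1 \<and> (\<forall>p \<in> Gamma_planes. \<not> l \<subseteq> p)}"

definition lines_in_plane :: "('a::field ^ 4) set set \<Rightarrow> ('a ^ 4) set \<Rightarrow> nat" where
  "lines_in_plane L p = card {l \<in> L. l \<subseteq> p}"

definition planes_through_line :: "('a::field ^ 4) set set \<Rightarrow> ('a ^ 4) set \<Rightarrow> nat" where
  "planes_through_line \<P> l = card {p \<in> \<P>. l \<subseteq> p}"

definition avg_planes_through :: "('a::field ^ 4) set set \<Rightarrow> ('a ^ 4) set set \<Rightarrow> real" where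
  "avg_planes_through \<P> L = (\<Sum>l\<in>L. real (planes_through_line \<P> l)) / real (card L)"

end

theory Submission
  imports Defs
begin

text \<open>
  Index the points of the cubic by \<open>x = (a, b) \<in> {(1, 0)} \<union> {(t, 1)}\<close>, with vector
  \<open>P x = (a\<^sup>3, a\<^sup>2b, ab\<^sup>2, b\<^sup>3)\<close>, and put \<open>[w, x] = w\<^sub>0x\<^sub>1 - w\<^sub>1x\<^sub>0\<close>.  For any three indices there is a
  linear form whose value at \<open>P w\<close> is \<open>[w, x][w, y][w, z]\<close>; the osculating plane at \<open>x\<close> is the
  case \<open>x = y = z\<close>, so no characteristic is special.  These forms show that at most four points of
  the cubic are always independent, and that the Un\<open>\<Gamma>\<close>-lines through \<open>P x\<close> are the lines outside
  the osculating plane at \<open>x\<close> that are not chords.  In a subspace of dimension \<open>e + 2\<close> that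
  contains \<open>P x\<close> and does not lie in that plane there are \<open>q\<^sup>e\<close> lines through \<open>P x\<close> outside it,
  from which the chords are subtracted.  The plane classes are counted by double counting
  \<open>k\<close>-subsets of the cubic with the planes containing them, and the averages follow by
  counting incident pairs.
\<close>

section \<open>Counting in subspaces of a finite vector space\<close>

lemma sum_card_swap:
  assumes "finite A" "finite B"
  shows "(\<Sum>a\<in>A. card {b\<in>B. R a b}) = (\<Sum>b\<in>B. card {a\<in>A. R a b})"
  using sum.swap_restrict[OF assms, of "\<lambda>_ _. 1 :: nat" R] by simp

lemma card_span_independent:
  fixes B :: "('a::{field,finite} ^ 'n::finite) set"
  assumes "vec.independent B"
  shows "card (vec.span B) = CARD('a) ^ card B"
proof -
  have "finite B" by simp
  then show ?thesis using assms
  proof (induction B rule: finite_induct)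
    case (insert b B)
    then have nb: "b \<notin> vec.span B" and ind: "vec.independent B"
      by (auto simp: vec.independent_insert)
    let ?f = "\<lambda>(k, y). k *s b + y"
    have "inj_on ?f (UNIV \<times> vec.span B)"
    proof (rule inj_onI, clarify)
      fix k y k' y'
      assume y: "y \<in> vec.span B" "y' \<in> vec.span B" and eq: "k *s b + y = k' *s b + y'"
      have *: "(k - k') *s b = y' - y"
        using eq by (simp add: vec.scale_left_diff_distrib algebra_simps)
      have "k = k'"
      proof (rule ccontr)
        assume "k \<noteq> k'"
        moreover have "(k - k') *s b \<in> vec.span B"
          unfolding * using y by (simp add: vec.span_diff)
        ultimately show False
          using nb vec.span_scale[of "(k - k') *s b" B "inverse (k - k')"]
          by (simp only: vec.scale_scale) simp
      qed
      then show "k = k' \<and> y = y'" using eq by simp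
    qed
    moreover have "?f ` (UNIV \<times> vec.span B) = vec.span (insert b B)"
    proof (intro set_eqI iffI)
      fix x assume "x \<in> vec.span (insert b B)"
      then obtain k where "x - k *s b \<in> vec.span B"
        unfolding vec.span_insert by auto
      then show "x \<in> ?f ` (UNIV \<times> vec.span B)"
        by (intro image_eqI[of _ _ "(k, x - k *s b)"]) auto
    next
      fix x assume "x \<in> ?f ` (UNIV \<times> vec.span B)"
      then obtain k y where "x = k *s b + y" "y \<in> vec.span B" by auto
      then have "x - k *s b \<in> vec.span B" by simp
      then show "x \<in> vec.span (insert b B)" unfolding vec.span_insert by blast
    qed
    ultimately have "card (vec.span (insert b B)) = card ((UNIV :: 'a set) \<times> vec.span B)"
      by (metis card_image)
    with insert.IH[OF ind] insert.hyps show ?case by (simp add: card_cartesian_product)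
  qed simp
qed

lemma card_subspace:
  fixes S :: "('a::{field,finite} ^ 'n::finite) set"
  assumes "vec.subspace S"
  shows "card S = CARD('a) ^ vec.dim S"
proof -
  obtain B where "B \<subseteq> S" "vec.independent B" "S \<subseteq> vec.span B" "card B = vec.dim S"
    using vec.basis_exists by blast
  moreover from this have "vec.span B = S"
    using assms by (simp add: vec.span_subspace)
  ultimately show ?thesis using card_span_independent[of B] by simp
qed

text \<open>The sets \<open>L - X\<close> partition \<open>W - X\<close>: a vector of
  \<open>W\<close> outside \<open>X\<close> spans together with \<open>U\<close> a member of the
  family, and every \<open>L\<close> meets \<open>X\<close> exactly in \<open>U\<close> because its
  dimension exceeds that of \<open>U\<close> by one. So all blocks have the same size, the second
  factor on the left.\<close>

lemma card_subspaces_above: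
  fixes U X W :: "('a::{field,finite} ^ 'n::finite) set"
  assumes U: "vec.subspace U" and X: "vec.subspace X" and W: "vec.subspace W"
    and UX: "U \<subseteq> X" and XW: "X \<subseteq> W"
  shows "card {L. vec.subspace L \<and> vec.dim L = Suc (vec.dim U) \<and> U \<subseteq> L \<and> L \<subseteq> W \<and> \<not> L \<subseteq> X}
           * (CARD('a) ^ Suc (vec.dim U) - CARD('a) ^ vec.dim U)
         = CARD('a) ^ vec.dim W - CARD('a) ^ vec.dim X"
proof -
  let ?A = "{L. vec.subspace L \<and> vec.dim L = Suc (vec.dim U) \<and> U \<subseteq> L \<and> L \<subseteq> W \<and> \<not> L \<subseteq> X}"
  \<comment> \<open>\<open>M\<close> stays general because it has two roles: \<open>M = X\<close>
    gives the block size, a second member of the family gives disjointness.\<close>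
  have inter: "L \<inter> M = U"
    if L: "vec.subspace L" "vec.dim L = Suc (vec.dim U)" "U \<subseteq> L" "\<not> L \<subseteq> M"
      and M: "vec.subspace M" "U \<subseteq> M" for L M :: "('a ^ 'n) set"
  proof -
    have sub: "vec.subspace (L \<inter> M)" using L(1) M(1) by (rule vec.subspace_inter)
    have "vec.dim (L \<inter> M) \<noteq> Suc (vec.dim U)"
      using vec.subspace_dim_equal[OF sub L(1)] L(2,4) by auto
    moreover have "vec.dim (L \<inter> M) \<le> Suc (vec.dim U)"
      using vec.dim_subset[of "L \<inter> M" L] L(2) by simp
    ultimately show ?thesis
      using vec.subspace_dim_equal[OF U sub] L(3) M(2) by auto
  qed
  have cover: "W - X = (\<Union>L\<in>?A. L - X)"
  proof (intro set_eqI iffI)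
    fix v assume v: "v \<in> W - X"
    have nU: "v \<notin> vec.span U" using v UX U by (simp add: vec.span_eq_iff[THEN iffD2]) blast
    let ?L = "vec.span (insert v U)"
    have "?L \<subseteq> W" using v UX XW W by (intro vec.span_minimal) auto
    moreover have "v \<in> ?L" "U \<subseteq> ?L" by (auto intro: vec.span_base)
    moreover have "vec.dim ?L = Suc (vec.dim U)" using nU by (simp add: vec.dim_insert)
    ultimately have "?L \<in> ?A" using v by auto
    with \<open>v \<in> ?L\<close> v show "v \<in> (\<Union>L\<in>?A. L - X)" by blast
  qed auto
  have "card (W - X) = (\<Sum>L\<in>?A. card (L - X))"
    unfolding cover
  proof (rule card_UN_disjoint; clarsimp)
    fix L M assume "vec.subspace L" "vec.dim L = Suc (vec.dim U)" "U \<subseteq> L"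
      "vec.subspace M" "vec.dim M = Suc (vec.dim U)" "U \<subseteq> M" "L \<noteq> M"
    then have "L \<inter> M = U"
      using inter[of L M] vec.subspace_dim_equal[of L M] by auto
    with UX show "(L - X) \<inter> (M - X) = {}" by auto
  qed
  also have "\<dots> = (\<Sum>L\<in>?A. CARD('a) ^ Suc (vec.dim U) - CARD('a) ^ vec.dim U)"
  proof (rule sum.cong)
    fix L assume L: "L \<in> ?A"
    then have "L \<inter> X = U" "card L = CARD('a) ^ Suc (vec.dim U)"
      using inter[of L X] X UX card_subspace[of L] by auto
    moreover have "card (L - X) = card L - card (L \<inter> X)"
      by (rule card_Diff_subset_Int) (rule finite)
    ultimately show "card (L - X) = CARD('a) ^ Suc (vec.dim U) - CARD('a) ^ vec.dim U"
      using card_subspace[OF U] by presburger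
  qed simp
  finally have "card (W - X) = card ?A * (CARD('a) ^ Suc (vec.dim U) - CARD('a) ^ vec.dim U)"
    by simp
  moreover have "card (W - X) = card W - card X"
    by (rule card_Diff_subset[OF finite XW])
  ultimately show ?thesis using X W by (simp add: card_subspace)
qed

section \<open>The parametrised cubic, its linear forms and the osculating planes\<close>

definition params :: "('a::field \<times> 'a) set" where
  "params = insert (1, 0) (range (\<lambda>t. (t, 1)))"

definition bracket :: "'a::field \<times> 'a \<Rightarrow> 'a \<times> 'a \<Rightarrow> 'a" where
  "bracket x y = fst x * snd y - snd x * fst y"

definition cubic_vec :: "'a::field \<times> 'a \<Rightarrow> 'a ^ 4" where
  "cubic_vec x = vector [fst x ^ 3, fst x ^ 2 * snd x, fst x * snd x ^ 2, snd x ^ 3]"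

text \<open>These are the coefficients of the binary cubic \<open>[w, x][w, y][w, z]\<close> with
  respect to the monomials of degree 3 in \<open>w\<close>, which are the entries of
  \<open>cubic_vec w\<close>.\<close>

definition cubic_form :: "'a::field \<times> 'a \<Rightarrow> 'a \<times> 'a \<Rightarrow> 'a \<times> 'a \<Rightarrow> 'a ^ 4" where
  "cubic_form x y z = vector [snd x * snd y * snd z,
     - (fst x * snd y * snd z + snd x * fst y * snd z + snd x * snd y * fst z),
     fst x * fst y * snd z + fst x * snd y * fst z + snd x * fst y * fst z,
     - (fst x * fst y * fst z)]"

text \<open>The bracket is a determinant and detects proportional pairs; \<open>params\<close> holds
  one normalised representative of each point of the projective line, so proportional means
  equal.\<close>

lemma bracket_eq_0_iff: "x \<in> params \<Longrightarrow> y \<in> params \<Longrightarrow> bracket x y = 0 \<longleftrightarrow> x = y"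
  by (auto simp: params_def bracket_def)

lemma vector4_nth [simp]:
  "(vector [a, b, c, d] :: 'a::zero ^ 4) $ 1 = a"
  "(vector [a, b, c, d] :: 'a::zero ^ 4) $ 2 = b"
  "(vector [a, b, c, d] :: 'a::zero ^ 4) $ 3 = c"
  "(vector [a, b, c, d] :: 'a::zero ^ 4) $ 4 = d"
  unfolding vector_def by simp_all

lemma mem_hyperplane_of:
  "v \<in> hyperplane_of c \<longleftrightarrow> c $ 1 * v $ 1 + c $ 2 * v $ 2 + c $ 3 * v $ 3 + c $ 4 * v $ 4 = 0"
  by (simp add: hyperplane_of_def sum_4)

lemma subspace_hyperplane_of: "vec.subspace (hyperplane_of c)"
  by (rule vec.subspaceI)
    (auto simp: hyperplane_of_def distrib_left sum.distrib mult.left_commute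
      simp flip: sum_distrib_left)

text \<open>Repetitions among \<open>x\<close>, \<open>y\<close>, \<open>z\<close> are allowed. They
  give the osculating planes, and later serve sets of fewer than three parameters.\<close>

lemma cubic_vec_mem_hyperplane_of_cubic_form:
  assumes "w \<in> params" "x \<in> params" "y \<in> params" "z \<in> params"
  shows "cubic_vec w \<in> hyperplane_of (cubic_form x y z) \<longleftrightarrow> w \<in> {x, y, z}"
proof -
  have "cubic_vec w \<in> hyperplane_of (cubic_form x y z) \<longleftrightarrow>
      bracket w x * bracket w y * bracket w z = 0"
    unfolding mem_hyperplane_of bracket_def cubic_vec_def cubic_form_def
    by (simp add: algebra_simps power2_eq_square power3_eq_cube)
  then show ?thesis using assms by (auto simp: bracket_eq_0_iff)
qed

abbreviation osculating :: "'a::field \<times> 'a \<Rightarrow> ('a ^ 4) set" where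
  "osculating x \<equiv> hyperplane_of (cubic_form x x x)"

lemma Gamma_planes_eq: "Gamma_planes = osculating ` params"
proof -
  \<comment> \<open>The form at \<open>(1, 0)\<close> is (0, 0, 0, -1), which may differ from the
    prescribed vector by its sign, so planes are compared here and not vectors.\<close>
  have "osculating (1, 0) = hyperplane_of (vector [0, 0, 0, 1 :: 'a])"
    by (auto simp: mem_hyperplane_of cubic_form_def)
  moreover have "cubic_form (t, 1) (t, 1) (t, 1) = vector [1, - 3 * t, 3 * t ^ 2, - (t ^ 3)]" for t :: 'a
    by (simp add: cubic_form_def power2_eq_square power3_eq_cube)
  ultimately show ?thesis
    by (simp add: Gamma_planes_def params_def image_image)
qed

lemma osculating_iff:
  "x \<in> params \<Longrightarrow> y \<in> params \<Longrightarrow> cubic_vec y \<in> osculating x \<longleftrightarrow> y = x"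
  by (simp add: cubic_vec_mem_hyperplane_of_cubic_form)

lemma cubic_vec_nonzero: "x \<in> params \<Longrightarrow> cubic_vec x \<noteq> 0"
  by (auto simp: params_def cubic_vec_def vec_eq_iff forall_4)

lemma dim_Int_hyperplane_of:
  fixes W :: "('a::field ^ 4) set"
  assumes "vec.subspace W" "\<not> W \<subseteq> hyperplane_of c"
  shows "vec.dim W = Suc (vec.dim (W \<inter> hyperplane_of c))"
proof -
  let ?H = "hyperplane_of c" and ?f = "\<lambda>x. \<Sum>i\<in>UNIV. c $ i * x $ i"
  obtain w where w: "w \<in> W" "w \<notin> ?H" using assms(2) by blast
  have sub: "vec.subspace (W \<inter> ?H)"
    using assms(1) subspace_hyperplane_of by (rule vec.subspace_inter)
  have "W = vec.span (insert w (W \<inter> ?H))"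
  proof
    show "vec.span (insert w (W \<inter> ?H)) \<subseteq> W"
      using w assms(1) by (intro vec.span_minimal) auto
    show "W \<subseteq> vec.span (insert w (W \<inter> ?H))"
    proof
      fix v assume v: "v \<in> W"
      \<comment> \<open>Chosen so that the linear form vanishes at
        \<open>v - k *s w\<close>.\<close>
      define k where "k = ?f v / ?f w"
      have "?f (v - k *s w) = ?f v - k * ?f w"
        by (simp add: right_diff_distrib sum_subtractf sum_distrib_left mult.left_commute)
      also have "\<dots> = 0" using w by (simp add: k_def hyperplane_of_def)
      finally have "v - k *s w \<in> W \<inter> ?H"
        using v w assms(1) by (simp add: hyperplane_of_def vec.subspace_diff vec.subspace_scale)
      then show "v \<in> vec.span (insert w (W \<inter> ?H))"
        unfolding vec.span_insert by (auto intro: vec.span_base)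
    qed
  qed
  moreover have "w \<notin> vec.span (W \<inter> ?H)"
    using w sub by (simp add: vec.span_eq_iff[THEN iffD2])
  ultimately show ?thesis by (metis vec.dim_insert vec.dim_span Suc_eq_plus1)
qed

lemma card_field_ge_2: "2 \<le> CARD('a::{field,finite})"
proof -
  have "card {0, 1 :: 'a} \<le> CARD('a)" by (rule card_mono) auto
  then show ?thesis by simp
qed

lemma inj_osculating: "inj_on osculating params"
proof (rule inj_onI)
  fix x y :: "'a \<times> 'a" assume "x \<in> params" "y \<in> params" "osculating x = osculating y"
  then show "x = y" using osculating_iff[of x x] osculating_iff[of y x] by simp
qed

lemma osculating_in_pg_planes:
  assumes "x \<in> params"
  shows "osculating x \<in> pg_planes"
proof -
  \<comment> \<open>A second parameter gives a cubic point off the hyperplane, which is therefore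
    proper and loses exactly one dimension.\<close>
  obtain y :: "'a \<times> 'a" where "y \<in> params" "y \<noteq> x"
    by (metis Pair_inject insertCI one_neq_zero params_def rangeI)
  then have "\<not> UNIV \<subseteq> osculating x" using osculating_iff[OF assms] by blast
  then have "vec.dim (UNIV :: ('a ^ 4) set) = Suc (vec.dim (osculating x))"
    using dim_Int_hyperplane_of[of UNIV] by simp
  then show ?thesis by (simp add: pg_planes_def subspace_hyperplane_of card_cart_basis)
qed

lemma card_params: "card (params :: ('a::{field,finite} \<times> 'a) set) = CARD('a) + 1"
proof -
  have "card (range (\<lambda>t :: 'a. (t, 1 :: 'a))) = CARD('a)"
    by (intro card_image inj_onI) simp
  then show ?thesis unfolding params_def by (subst card_insert_disjoint) auto
qed

section \<open>Cubic points in a subspace and their independence\<close>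

definition params_on :: "('a::field ^ 4) set \<Rightarrow> ('a \<times> 'a) set" where
  "params_on S = {x \<in> params. cubic_vec x \<in> S}"

text \<open>With repetitions a nonempty \<open>S\<close> has the form \<open>{x, y, z}\<close>, and
  \<open>cubic_form x y z\<close> vanishes on the whole span but at no other cubic vector. For empty
  \<open>S\<close> the span is zero, while cubic vectors are nonzero.\<close>

lemma params_on_span:
  assumes "S \<subseteq> params" "finite S" "card S \<le> 3"
  shows "params_on (vec.span (cubic_vec ` S)) = S"
proof (intro set_eqI iffI)
  fix w assume w: "w \<in> params_on (vec.span (cubic_vec ` S))"
  show "w \<in> S"
  proof (cases "S = {}")
    case True
    then show ?thesis using w cubic_vec_nonzero[of w] by (simp add: params_on_def)
  next
    case False
    have "\<exists>x y z. S = {x, y, z}"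
    proof -
      have "card S = Suc 0 \<or> card S = 2 \<or> card S = 3"
        using False assms by (auto simp: le_Suc_eq numeral_eq_Suc)
      then consider x where "S = {x, x, x}" | x y where "S = {x, y, y}" | x y z where "S = {x, y, z}"
        unfolding card_1_singleton_iff card_2_iff card_3_iff insert_absorb2 by (elim disjE exE conjE)
      then show ?thesis by cases (intro exI, assumption)+
    qed
    then obtain x y z where S: "S = {x, y, z}" by blast
    have "vec.span (cubic_vec ` S) \<subseteq> hyperplane_of (cubic_form x y z)"
      using assms(1) unfolding S
      by (intro vec.span_minimal subspace_hyperplane_of)
        (auto simp: cubic_vec_mem_hyperplane_of_cubic_form)
    then have "cubic_vec w \<in> hyperplane_of (cubic_form x y z)" "w \<in> params"
      using w by (auto simp: params_on_def)
    then show ?thesis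
      using assms(1) cubic_vec_mem_hyperplane_of_cubic_form[of w x y z] unfolding S by simp
  qed
next
  fix w assume "w \<in> S"
  then show "w \<in> params_on (vec.span (cubic_vec ` S))"
    using assms(1) vec.span_base[of "cubic_vec w" "cubic_vec ` S"] by (auto simp: params_on_def)
qed

text \<open>Each added vector lies off the span of the earlier ones by
  \<open>params_on_span\<close>; the bound 4 is the 3 of that lemma plus the last vector
  added.\<close>

lemma dim_cubic_vec_image:
  assumes "finite S" "S \<subseteq> params" "card S \<le> 4"
  shows "vec.dim (cubic_vec ` S) = card S"
  using assms
proof (induction S rule: finite_induct)
  case (insert x S)
  then have "x \<notin> params_on (vec.span (cubic_vec ` S))"
    by (subst params_on_span) auto
  then show ?case using insert by (simp add: params_on_def vec.dim_insert)
qed simp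

lemma card_params_on_plane:
  fixes p :: "('a::{field,finite} ^ 4) set"
  assumes "p \<in> pg_planes"
  shows "card (params_on p) \<le> 3"
proof (rule ccontr)
  assume "\<not> card (params_on p) \<le> 3"
  then obtain S where S: "S \<subseteq> params_on p" "card S = 4"
    using obtain_subset_with_card_n[of 4 "params_on p"] by auto
  then have "vec.dim (cubic_vec ` S) = 4"
    by (subst dim_cubic_vec_image) (auto simp: params_on_def)
  moreover have "cubic_vec ` S \<subseteq> p" using S by (auto simp: params_on_def)
  ultimately show False
    using assms vec.dim_subset[of "cubic_vec ` S" p] by (simp add: pg_planes_def)
qed

lemma pg_point_subset_iff: "vec.subspace S \<Longrightarrow> pg_point v \<subseteq> S \<longleftrightarrow> v \<in> S"
  unfolding pg_point_def by (metis empty_subsetI insert_subset order_trans vec.span_minimal vec.span_superset)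

text \<open>Distinct parameters give distinct points, since the osculating plane at \<open>y\<close>
  contains the point of \<open>y\<close> and no other point of the cubic.\<close>

lemma card_cubic_points_on:
  fixes S :: "('a::{field,finite} ^ 4) set"
  assumes "vec.subspace S"
  shows "card (cubic_points_on S) = card (params_on S)"
proof -
  let ?P = "\<lambda>x. pg_point (cubic_vec x)"
  have tc: "twisted_cubic = ?P ` (params :: ('a \<times> 'a) set)"
    by (simp add: twisted_cubic_def params_def cubic_vec_def image_image)
  have "inj_on ?P (params :: ('a \<times> 'a) set)"
  proof (rule inj_onI)
    fix x y :: "'a \<times> 'a" assume xy: "x \<in> params" "y \<in> params" "?P x = ?P y"
    have "cubic_vec x \<in> ?P x" by (simp add: pg_point_def vec.span_base)
    moreover have "?P y \<subseteq> osculating y"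
      using xy by (simp add: pg_point_subset_iff subspace_hyperplane_of osculating_iff)
    ultimately show "x = y" using xy osculating_iff by blast
  qed
  then have "inj_on ?P (params_on S)" by (rule inj_on_subset) (auto simp: params_on_def)
  moreover have "cubic_points_on S = ?P ` {x \<in> params. ?P x \<subseteq> S}"
    by (auto simp: cubic_points_on_def tc)
  then have "cubic_points_on S = ?P ` params_on S"
    using assms by (simp add: params_on_def pg_point_subset_iff)
  ultimately show ?thesis by (simp add: card_image)
qed

section \<open>Lines and planes through a given subspace\<close>

lemma card_lines_through_point:
  fixes U W :: "('a::{field,finite} ^ 4) set"
  assumes U: "vec.subspace U" "vec.dim U = 1" and W: "vec.subspace W" and UW: "U \<subseteq> W"
  shows "card {l \<in> pg_lines. U \<subseteq> l \<and> l \<subseteq> W} * (CARD('a) - 1) = CARD('a) ^ (vec.dim W - 1) - 1"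
proof -
  \<comment> \<open>With \<open>X = U\<close> the clause \<open>\<not> L \<subseteq> U\<close> holds
    by dimension, so \<open>card_subspaces_above\<close> counts all the lines in question.\<close>
  have "{l \<in> pg_lines. U \<subseteq> l \<and> l \<subseteq> W} =
    {L. vec.subspace L \<and> vec.dim L = Suc (vec.dim U) \<and> U \<subseteq> L \<and> L \<subseteq> W \<and> \<not> L \<subseteq> U}"
    using U vec.dim_subset[of _ U] by (fastforce simp: pg_lines_def)
  then have "card {l \<in> pg_lines. U \<subseteq> l \<and> l \<subseteq> W} * (CARD('a)\<^sup>2 - CARD('a)) =
      CARD('a) ^ vec.dim W - CARD('a)"
    using card_subspaces_above[OF U(1) U(1) W _ UW] U(2) by (simp add: power2_eq_square)
  moreover have "vec.dim W = Suc (vec.dim W - 1)"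
    using vec.dim_subset[OF UW] U(2) by simp
  then have "CARD('a) ^ vec.dim W - CARD('a) = CARD('a) * (CARD('a) ^ (vec.dim W - 1) - 1)"
    by (metis diff_mult_distrib2 mult.right_neutral power_Suc)
  moreover have "CARD('a)\<^sup>2 - CARD('a) = CARD('a) * (CARD('a) - 1)"
    by (simp add: power2_eq_square diff_mult_distrib2)
  ultimately show ?thesis by simp
qed

lemma card_planes_through_line:
  fixes l :: "('a::{field,finite} ^ 4) set"
  assumes l: "vec.subspace l" "vec.dim l = 2"
  shows "card {p \<in> pg_planes. l \<subseteq> p} = CARD('a) + 1"
proof -
  \<comment> \<open>Writing \<open>CARD('a)\<close> as \<open>Suc r\<close> removes truncated
    subtraction, and \<open>r > 0\<close> permits cancelling the common factor.\<close>
  obtain r where r: "CARD('a) = Suc r" "r > 0" using card_field_ge_2[where ?'a = 'a]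
    by (cases "CARD('a)") auto
  have "{p \<in> pg_planes. l \<subseteq> p} =
    {L. vec.subspace L \<and> vec.dim L = Suc (vec.dim l) \<and> l \<subseteq> L \<and> L \<subseteq> UNIV \<and> \<not> L \<subseteq> l}"
    using l vec.dim_subset[of _ l] by (fastforce simp: pg_planes_def)
  then have "card {p \<in> pg_planes. l \<subseteq> p} * (CARD('a) ^ 3 - CARD('a) ^ 2) =
      CARD('a) ^ 4 - CARD('a) ^ 2"
    using card_subspaces_above[OF l(1) l(1), of UNIV] l(2)
    by (simp add: card_cart_basis eval_nat_numeral)
  moreover have "Suc r ^ 3 - Suc r ^ 2 = Suc r ^ 2 * r"
    "Suc r ^ 4 - Suc r ^ 2 = (Suc r + 1) * (Suc r ^ 2 * r)"
    by (simp_all add: eval_nat_numeral algebra_simps)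
  ultimately have "card {p \<in> pg_planes. l \<subseteq> p} * (Suc r ^ 2 * r) = (Suc r + 1) * (Suc r ^ 2 * r)"
    unfolding r(1) by (simp only:)
  then show ?thesis using r unfolding mult_cancel2 by auto
qed

text \<open>\<open>card_subspaces_above\<close> climbs one dimension only, so flags
  \<open>U \<subseteq> l \<subseteq> p\<close> are counted. Each plane through \<open>U\<close>
  contains \<open>q + 1\<close> such lines and each line lies in \<open>q + 1\<close> planes; hence
  planes and lines through \<open>U\<close> are equally many.\<close>

lemma card_planes_through_point:
  fixes U :: "('a::{field,finite} ^ 4) set"
  assumes U: "vec.subspace U" "vec.dim U = 1"
  shows "card {p \<in> pg_planes. U \<subseteq> p} = CARD('a) ^ 2 + CARD('a) + 1"
proof -
  obtain r where r: "CARD('a) = Suc r" "r > 0" using card_field_ge_2[where ?'a = 'a]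
    by (cases "CARD('a)") auto
  let ?A = "{p \<in> pg_planes. U \<subseteq> p}" and ?B = "{l \<in> pg_lines. U \<subseteq> l}"
  have "card {l \<in> ?B. l \<subseteq> p} = CARD('a) + 1" if p: "p \<in> ?A" for p
  proof -
    have "card {l \<in> pg_lines. U \<subseteq> l \<and> l \<subseteq> p} * r = (Suc r + 1) * r"
      using card_lines_through_point[OF U, of p] p r(1)
      by (auto simp: pg_planes_def power2_eq_square)
    then show ?thesis using r unfolding mult_cancel2 by (simp add: conj_assoc)
  qed
  then have "card ?A * (CARD('a) + 1) = (\<Sum>p\<in>?A. card {l \<in> ?B. l \<subseteq> p})" by simp
  also have "\<dots> = (\<Sum>l\<in>?B. card {p \<in> ?A. l \<subseteq> p})"
    by (rule sum_card_swap) simp_all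
  also have "\<dots> = (\<Sum>l\<in>?B. CARD('a) + 1)"
  proof (rule sum.cong)
    fix l assume l: "l \<in> ?B"
    then have "{p \<in> ?A. l \<subseteq> p} = {p \<in> pg_planes. l \<subseteq> p}" by auto
    then show "card {p \<in> ?A. l \<subseteq> p} = CARD('a) + 1"
      using l card_planes_through_line[of l] by (simp add: pg_lines_def)
  qed simp
  finally have "card ?A = card ?B" by (simp del: add_Suc_right add_Suc add_0_right One_nat_def)
  moreover have "card ?B * r = (Suc r ^ 2 + Suc r + 1) * r"
    using card_lines_through_point[OF U vec.subspace_UNIV] r(1)
    by (simp add: card_cart_basis eval_nat_numeral algebra_simps)
  ultimately show ?thesis using r unfolding mult_cancel2 by simp
qed

lemma card_planes_through_plane:
  fixes V :: "('a::{field,finite} ^ 4) set"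
  assumes V: "vec.subspace V" "vec.dim V = 3"
  shows "card {p \<in> pg_planes. V \<subseteq> p} = 1"
proof -
  have "{p \<in> pg_planes. V \<subseteq> p} = {V}"
  proof (intro set_eqI iffI)
    fix p assume "p \<in> {p \<in> pg_planes. V \<subseteq> p}"
    then show "p \<in> {V}"
      using V vec.subspace_dim_equal[of V p] by (simp add: pg_planes_def)
  qed (use V in \<open>simp add: pg_planes_def\<close>)
  then show ?thesis by simp
qed

section \<open>Sizes of the plane classes\<close>

text \<open>Pairs of a \<open>k\<close>-set of parameters and a plane containing its points are
  counted in two ways. As \<open>k \<le> 3\<close>, the points of the set span a subspace of
  dimension \<open>k\<close>, which lies in \<open>c\<close> planes.\<close>

lemma sum_choose_params_on:
  assumes k: "k \<le> 3"
    and c: "\<And>V :: ('a::{field,finite} ^ 4) set. vec.subspace V \<Longrightarrow> vec.dim V = k \<Longrightarrow>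
      card {p \<in> pg_planes. V \<subseteq> p} = c"
  shows "(\<Sum>p\<in>(pg_planes :: ('a ^ 4) set set). card (params_on p) choose k)
    = ((CARD('a) + 1) choose k) * c"
proof -
  let ?K = "{S. S \<subseteq> (params :: ('a \<times> 'a) set) \<and> card S = k}"
  have "(card (params_on p) choose k) = card {S \<in> ?K. cubic_vec ` S \<subseteq> p}" for p :: "('a ^ 4) set"
  proof -
    have "{S \<in> ?K. cubic_vec ` S \<subseteq> p} = {S. S \<subseteq> params_on p \<and> card S = k}"
      by (auto simp: params_on_def)
    then show ?thesis by (simp add: n_subsets)
  qed
  then have "(\<Sum>p\<in>(pg_planes :: ('a ^ 4) set set). card (params_on p) choose k)
    = (\<Sum>p\<in>pg_planes. card {S \<in> ?K. cubic_vec ` S \<subseteq> (p :: ('a ^ 4) set)})" by simp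
  also have "\<dots> = (\<Sum>S\<in>?K. card {p \<in> pg_planes. cubic_vec ` S \<subseteq> p})"
    by (rule sum_card_swap) simp_all
  also have "\<dots> = (\<Sum>S\<in>?K. c)"
  proof (rule sum.cong)
    fix S assume S: "S \<in> ?K"
    have "{p \<in> pg_planes. cubic_vec ` S \<subseteq> p} = {p \<in> pg_planes. vec.span (cubic_vec ` S) \<subseteq> p}"
    proof (intro Collect_cong conj_cong refl)
      fix p :: "('a ^ 4) set" assume "p \<in> pg_planes"
      then show "cubic_vec ` S \<subseteq> p \<longleftrightarrow> vec.span (cubic_vec ` S) \<subseteq> p"
        using vec.span_superset[of "cubic_vec ` S"] vec.span_minimal[of "cubic_vec ` S" p]
        unfolding pg_planes_def by blast
    qed
    moreover have "card {p \<in> pg_planes. vec.span (cubic_vec ` S) \<subseteq> p} = c"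
    proof (rule c[OF vec.subspace_span])
      have "finite S" "S \<subseteq> params" "card S = k" using S by auto
      then show "vec.dim (vec.span (cubic_vec ` S)) = k"
        using k dim_cubic_vec_image[of S] unfolding vec.dim_span by linarith
    qed
    ultimately show "card {p \<in> pg_planes. cubic_vec ` S \<subseteq> p} = c" by simp
  qed simp
  also have "\<dots> = ((CARD('a) + 1) choose k) * c"
    by (simp add: n_subsets card_params)
  finally show ?thesis .
qed

lemma two_times_choose_two: "2 * ((r + 2) choose 2) = (r + 2) * (r + 1)"
  by (simp add: choose_two)

text \<open>The index \<open>r + 2\<close> keeps the product free of subtraction; the lemma is used
  with \<open>r = q - 1\<close>. Pascal's rule reduces the induction step to
  \<open>two_times_choose_two\<close>.\<close>

lemma six_times_choose_three: "6 * ((r + 2) choose 3) = (r + 2) * (r + 1) * r"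
proof (induction r)
  case (Suc r)
  have "(Suc r + 2) choose 3 = ((r + 2) choose 2) + ((r + 2) choose 3)"
    by (simp add: numeral_3_eq_3 numeral_2_eq_2)
  then have "6 * ((Suc r + 2) choose 3) = 3 * (2 * ((r + 2) choose 2)) + 6 * ((r + 2) choose 3)"
    by simp
  then show ?case
    unfolding Suc.IH two_times_choose_two by (simp add: algebra_simps)
qed simp

text \<open>A plane has at most three cubic points, so \<open>m choose 3\<close> is the indicator of
  \<open>m = 3\<close>; and three distinct cubic points lie in exactly one plane.\<close>

lemma card_planes_three:
  "card {p \<in> (pg_planes :: ('a::{field,finite} ^ 4) set set). card (params_on p) = 3}
    = (CARD('a) + 1) choose 3" (is "card ?A = _")
proof -
  have "card ?A = (\<Sum>p\<in>pg_planes. card (params_on (p :: ('a ^ 4) set)) choose 3)"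
  proof -
    have "(card (params_on p) choose 3) = (if card (params_on p) = 3 then 1 else 0)"
      if "p \<in> pg_planes" for p :: "('a ^ 4) set"
      using card_params_on_plane[OF that] by (auto simp: binomial_eq_0)
    then show ?thesis by (simp add: sum.If_cases Collect_conj_eq)
  qed
  then show ?thesis
    using sum_choose_params_on[of 3 1, where ?'a = 'a] by (simp add: card_planes_through_plane)
qed

text \<open>For \<open>m \<le> 3\<close> one has \<open>m - 2 \<cdot> (m choose 2) + 3 \<cdot> (m choose 3) = (if m = 1 then 1 else 0)\<close>.\<close>

lemma card_planes_one:
  "2 * card {p \<in> (pg_planes :: ('a::{field,finite} ^ 4) set set). card (params_on p) = 1}
    = (CARD('a) + 1) * (CARD('a) ^ 2 - CARD('a) + 2)" (is "2 * card ?A = _")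
proof -
  let ?q = "CARD('a)" and ?P = "pg_planes :: ('a ^ 4) set set"
  let ?m = "\<lambda>p :: ('a ^ 4) set. card (params_on p)"
  have "card ?A + 2 * (\<Sum>p\<in>?P. ?m p choose 2) = (\<Sum>p\<in>?P. ?m p choose 1) + 3 * (\<Sum>p\<in>?P. ?m p choose 3)"
  proof -
    have "(if ?m p = 1 then 1 else 0) + 2 * (?m p choose 2) = (?m p choose 1) + 3 * (?m p choose 3)"
      if "p \<in> ?P" for p
    proof -
      have "?m p = 0 \<or> ?m p = 1 \<or> ?m p = 2 \<or> ?m p = 3"
        using card_params_on_plane[OF that] by linarith
      then show ?thesis by (auto simp: eval_nat_numeral)
    qed
    then have "(\<Sum>p\<in>?P. (if ?m p = 1 then 1 else 0) + 2 * (?m p choose 2))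
        = (\<Sum>p\<in>?P. (?m p choose 1) + 3 * (?m p choose 3))" by (intro sum.cong) auto
    then show ?thesis
      by (simp add: sum.distrib sum.If_cases Collect_conj_eq flip: sum_distrib_left)
  qed
  moreover have "(\<Sum>p\<in>?P. ?m p choose 1) = ((?q + 1) choose 1) * (?q ^ 2 + ?q + 1)"
    by (rule sum_choose_params_on) (simp_all add: card_planes_through_point)
  moreover have "(\<Sum>p\<in>?P. ?m p choose 2) = ((?q + 1) choose 2) * (?q + 1)"
    by (rule sum_choose_params_on) (simp_all add: card_planes_through_line)
  moreover have "(\<Sum>p\<in>?P. ?m p choose 3) = ((?q + 1) choose 3) * 1"
    by (rule sum_choose_params_on) (simp_all add: card_planes_through_plane)
  ultimately have eq: "card ?A + 2 * (((?q + 1) choose 2) * (?q + 1))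
      = ((?q + 1) choose 1) * (?q ^ 2 + ?q + 1) + 3 * (((?q + 1) choose 3) * 1)"
    by (simp only:)
  obtain r where r: "?q = Suc r" using card_field_ge_2[where ?'a = 'a] by (cases ?q) auto
  have c2: "2 * ((?q + 1) choose 2) = (?q + 1) * ?q"
    using two_times_choose_two[of r] r by simp
  have c3: "6 * ((?q + 1) choose 3) = (?q + 1) * ?q * r"
    using six_times_choose_three[of r] r by simp
  \<comment> \<open>Doubling \<open>eq\<close> supplies the factors 2 and 6 that turn the binomial
    coefficients into the products \<open>c2\<close> and \<open>c3\<close>.\<close>
  have "2 * card ?A + 2 * (2 * ((?q + 1) choose 2)) * (?q + 1)
      = 2 * (?q + 1) * (?q ^ 2 + ?q + 1) + 6 * ((?q + 1) choose 3)"
    using eq by (simp add: algebra_simps)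
  then have "2 * card ?A + 2 * ((?q + 1) * ?q) * (?q + 1)
      = 2 * (?q + 1) * (?q ^ 2 + ?q + 1) + (?q + 1) * ?q * r"
    unfolding c2 c3 .
  moreover have "2 * (?q + 1) * (?q ^ 2 + ?q + 1) + (?q + 1) * ?q * r
      = (?q + 1) * (?q ^ 2 - ?q + 2) + 2 * ((?q + 1) * ?q) * (?q + 1)"
    unfolding r by (simp add: power2_eq_square algebra_simps)
  ultimately show ?thesis by simp
qed

lemma three_C_planes_eq:
  "three_C_planes = {p \<in> (pg_planes :: ('a::{field,finite} ^ 4) set set). card (params_on p) = 3}"
  by (auto simp: three_C_planes_def pg_planes_def card_cubic_points_on)

lemma one_C_bar_planes_eq:
  "one_C_bar_planes =
    {p \<in> (pg_planes :: ('a::{field,finite} ^ 4) set set). card (params_on p) = 1} - Gamma_planes"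
  by (auto simp: one_C_bar_planes_def pg_planes_def card_cubic_points_on)

text \<open>The osculating planes are \<open>q + 1\<close> distinct planes with one cubic point
  each, so they are subtracted from the count in \<open>card_planes_one\<close>.\<close>

lemma card_one_C_bar_planes:
  "2 * card (one_C_bar_planes :: ('a::{field,finite} ^ 4) set set)
    = (CARD('a) + 1) * (CARD('a) ^ 2 - CARD('a))"
proof -
  let ?A = "{p \<in> (pg_planes :: ('a ^ 4) set set). card (params_on p) = 1}"
  have "Gamma_planes \<subseteq> ?A"
  proof
    fix p :: "('a ^ 4) set" assume "p \<in> Gamma_planes"
    then obtain x where x: "x \<in> params" "p = osculating x" by (auto simp: Gamma_planes_eq)
    then have "params_on p = {x}" using osculating_iff[of x] by (auto simp: params_on_def)
    with x show "p \<in> ?A" by (simp add: osculating_in_pg_planes)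
  qed
  then have "card (one_C_bar_planes :: ('a ^ 4) set set) = card ?A - card (Gamma_planes :: ('a ^ 4) set set)"
    using card_Diff_subset[of Gamma_planes ?A] by (simp add: one_C_bar_planes_eq)
  moreover have "card (Gamma_planes :: ('a ^ 4) set set) = CARD('a) + 1"
    unfolding Gamma_planes_eq by (simp add: card_image inj_osculating card_params)
  ultimately show ?thesis
    using card_planes_one[where ?'a = 'a] by (simp add: diff_mult_distrib2 algebra_simps)
qed

section \<open>Un\<Gamma>-lines in a subspace\<close>

text \<open>Inside \<open>W\<close> the osculating plane at \<open>x\<close> cuts out dimension
  \<open>e + 1\<close>, so \<open>card_subspaces_above\<close> gives \<open>q ^ e\<close> lines
  through the point that leave it (the set \<open>A\<close>). Those that are not Un\<Gamma>-lines
  are the chords to the other cubic points in \<open>W\<close>, one for each such point.\<close>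

lemma card_UnGamma_lines_through_point:
  fixes W :: "('a::{field,finite} ^ 4) set"
  assumes W: "vec.subspace W" "vec.dim W = e + 2" and x: "x \<in> params_on W"
    and nosc: "\<not> W \<subseteq> osculating x"
  shows "card {l \<in> UnGamma_lines. l \<subseteq> W \<and> cubic_vec x \<in> l} + (card (params_on W) - 1) = CARD('a) ^ e"
proof -
  have xp: "x \<in> params" "cubic_vec x \<in> W" using x by (auto simp: params_on_def)
  let ?U = "vec.span {cubic_vec x}"
  let ?X = "W \<inter> osculating x"
  let ?chord = "\<lambda>y. vec.span {cubic_vec x, cubic_vec y}"
  define A where "A = {L. vec.subspace L \<and> vec.dim L = Suc (vec.dim ?U) \<and> ?U \<subseteq> L \<and> L \<subseteq> W \<and> \<not> L \<subseteq> ?X}"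
  define B where "B = {l \<in> UnGamma_lines. l \<subseteq> W \<and> cubic_vec x \<in> l}"
  have subX: "vec.subspace ?X"
    using W(1) subspace_hyperplane_of by (rule vec.subspace_inter)
  have dimU: "vec.dim ?U = 1"
    using cubic_vec_nonzero[OF xp(1)] by (simp add: vec.dim_insert)
  have Usub: "?U \<subseteq> S \<longleftrightarrow> cubic_vec x \<in> S" if "vec.subspace S" for S
    using pg_point_subset_iff[OF that, of "cubic_vec x"] by (simp add: pg_point_def)
  have dimX: "vec.dim ?X = e + 1"
    using dim_Int_hyperplane_of[OF W(1) nosc] W(2) by simp
  have osc: "cubic_vec x \<in> osculating x" using xp osculating_iff by blast
  have UX: "?U \<subseteq> ?X" using Usub[OF subX] xp osc by simp
  have "card A * (CARD('a) ^ 2 - CARD('a)) = CARD('a) ^ (e + 2) - CARD('a) ^ (e + 1)"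
    using card_subspaces_above[OF vec.subspace_span subX W(1) UX Int_lower1] dimX W(2)
    unfolding A_def dimU by (simp add: power2_eq_square)
  also have "\<dots> = CARD('a) ^ e * (CARD('a) ^ 2 - CARD('a))"
    by (simp add: power2_eq_square diff_mult_distrib2 mult_ac)
  finally have cardA: "card A = CARD('a) ^ e"
    using card_field_ge_2[where ?'a = 'a] by (simp add: power2_eq_square)
  have memA: "l \<in> A \<longleftrightarrow> l \<in> pg_lines \<and> l \<subseteq> W \<and> cubic_vec x \<in> l \<and> \<not> l \<subseteq> osculating x" for l
    unfolding A_def dimU pg_lines_def using Usub[of l] by auto
  have memB: "l \<in> B \<longleftrightarrow> l \<in> A \<and> params_on l = {x}" for l
  proof -
    have "card (params_on l) = 1 \<longleftrightarrow> params_on l = {x}" if "cubic_vec x \<in> l"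
    proof -
      have "x \<in> params_on l" using that xp(1) by (simp add: params_on_def)
      then show ?thesis unfolding One_nat_def card_1_singleton_iff by auto
    qed
    \<comment> \<open>Only the osculating plane at \<open>x\<close> has to be avoided, since those
      at other parameters miss the point of \<open>x\<close>.\<close>
    moreover have "(\<forall>p\<in>Gamma_planes. \<not> l \<subseteq> p) \<longleftrightarrow> \<not> l \<subseteq> osculating x" if "cubic_vec x \<in> l"
    proof -
      have "x = y" if "y \<in> params" "l \<subseteq> osculating y" for y
        using that xp(1) osculating_iff[of y x] \<open>cubic_vec x \<in> l\<close> by blast
      then show ?thesis using xp(1) unfolding Gamma_planes_eq by blast
    qed
    ultimately show ?thesis
      unfolding B_def memA UnGamma_lines_def using card_cubic_points_on[of l]
      by (auto simp: pg_lines_def)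
  qed
  have dimc: "vec.dim (?chord y) = 2" and ponc: "params_on (?chord y) = {x, y}"
    if "y \<in> params_on W - {x}" for y
  proof -
    have y: "y \<in> params" "y \<noteq> x" using that by (auto simp: params_on_def)
    have c: "card {x, y} = 2" "{x, y} \<subseteq> params" using xp y by auto
    have im: "cubic_vec ` {x, y} = {cubic_vec x, cubic_vec y}" by simp
    show "vec.dim (?chord y) = 2"
      using dim_cubic_vec_image[of "{x, y}"] c unfolding im vec.dim_span by simp
    show "params_on (?chord y) = {x, y}"
      using params_on_span[OF c(2)] c(1) unfolding im by simp
  qed
  \<comment> \<open>A line of \<open>A\<close> outside \<open>B\<close> has a second cubic point and
    so is a chord by dimension. Conversely, a chord leaves the osculating plane at \<open>x\<close>
    at its other cubic point \<open>y\<close>.\<close>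
  have "A - B = ?chord ` (params_on W - {x})"
  proof (intro set_eqI iffI)
    fix l assume l: "l \<in> A - B"
    then have lA: "l \<in> pg_lines" "l \<subseteq> W" "cubic_vec x \<in> l" by (auto simp: memA)
    moreover have "params_on l \<noteq> {x}" using l memB by blast
    moreover have "x \<in> params_on l" using lA xp by (simp add: params_on_def)
    ultimately obtain y where y: "y \<in> params_on l" "y \<noteq> x" by blast
    then have yW: "y \<in> params_on W - {x}" using lA by (auto simp: params_on_def)
    have "?chord y \<subseteq> l"
      using lA y by (intro vec.span_minimal) (auto simp: pg_lines_def params_on_def)
    then have "?chord y = l"
      using vec.subspace_dim_equal[OF vec.subspace_span, of l "{cubic_vec x, cubic_vec y}"]
        dimc[OF yW] lA by (simp add: pg_lines_def)
    with yW show "l \<in> ?chord ` (params_on W - {x})" by blast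
  next
    fix l assume "l \<in> ?chord ` (params_on W - {x})"
    then obtain y where y: "y \<in> params_on W - {x}" and l: "l = ?chord y" by blast
    have "params_on l \<noteq> {x}" using ponc[OF y] y l by auto
    moreover have "l \<in> pg_lines" using dimc[OF y] l by (simp add: pg_lines_def)
    moreover have "l \<subseteq> W"
      unfolding l using y xp W(1) by (intro vec.span_minimal) (auto simp: params_on_def)
    moreover have "cubic_vec x \<in> l" "cubic_vec y \<in> l"
      unfolding l by (auto intro: vec.span_base)
    moreover have "cubic_vec y \<notin> osculating x"
      using y xp(1) osculating_iff[of x y] by (auto simp: params_on_def)
    ultimately show "l \<in> A - B" unfolding Diff_iff memB memA by blast
  qed
  moreover have "inj_on ?chord (params_on W - {x})"
  proof (rule inj_onI)
    fix y z assume "y \<in> params_on W - {x}" "z \<in> params_on W - {x}" "?chord y = ?chord z"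
    then show "y = z" using ponc[of y] ponc[of z] by auto
  qed
  ultimately have "card (A - B) = card (params_on W) - 1"
    using x by (simp add: card_image)
  moreover have "B \<subseteq> A" using memB by blast
  then have "card A = card B + card (A - B)"
    by (metis card_Diff_subset card_mono finite le_add_diff_inverse)
  ultimately show ?thesis using cardA unfolding B_def by simp
qed

text \<open>Each Un\<Gamma>-line has exactly one cubic point, so the counts through the cubic points
  of \<open>W\<close> add up. Despite the name \<open>lines_in_plane\<close>, \<open>W\<close> may
  be all of space: \<open>e = 1\<close> gives planes, \<open>e = 2\<close> the total number of
  lines.\<close>

lemma lines_in_plane_UnGamma_lines:
  fixes W :: "('a::{field,finite} ^ 4) set"
  assumes W: "vec.subspace W" "vec.dim W = e + 2"
    and nosc: "\<And>x. x \<in> params_on W \<Longrightarrow> \<not> W \<subseteq> osculating x"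
  shows "lines_in_plane UnGamma_lines W
    = card (params_on W) * (CARD('a) ^ e - (card (params_on W) - 1))"
proof -
  let ?L = "{l \<in> UnGamma_lines. l \<subseteq> W}"
  have "card {x \<in> params_on W. cubic_vec x \<in> l} = 1" if "l \<in> ?L" for l
  proof -
    have "{x \<in> params_on W. cubic_vec x \<in> l} = params_on l"
      using that by (auto simp: params_on_def)
    then show ?thesis
      using that card_cubic_points_on[of l] by (simp add: UnGamma_lines_def pg_lines_def)
  qed
  then have "card ?L = (\<Sum>l\<in>?L. card {x \<in> params_on W. cubic_vec x \<in> l})" by simp
  also have "\<dots> = (\<Sum>x\<in>params_on W. card {l \<in> ?L. cubic_vec x \<in> l})"
    by (rule sum_card_swap) simp_all
  also have "\<dots> = (\<Sum>x\<in>params_on W. CARD('a) ^ e - (card (params_on W) - 1))"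
  proof (rule sum.cong)
    fix x assume x: "x \<in> params_on W"
    have "{l \<in> ?L. cubic_vec x \<in> l} = {l \<in> UnGamma_lines. l \<subseteq> W \<and> cubic_vec x \<in> l}" by auto
    then show "card {l \<in> ?L. cubic_vec x \<in> l} = CARD('a) ^ e - (card (params_on W) - 1)"
      using card_UnGamma_lines_through_point[OF W x nosc[OF x]] by simp
  qed simp
  finally show ?thesis by (simp add: lines_in_plane_def)
qed

section \<open>Line counts for the whole space and the two plane classes, and the averages\<close>

lemma card_UnGamma_lines:
  "card (UnGamma_lines :: ('a::{field,finite} ^ 4) set set) = (CARD('a) + 1) * (CARD('a) ^ 2 - CARD('a))"
proof -
  have on: "params_on (UNIV :: ('a ^ 4) set) = params" by (simp add: params_on_def)
  have "\<not> UNIV \<subseteq> osculating x" if "x \<in> params" for x :: "'a \<times> 'a"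
  proof
    assume "UNIV \<subseteq> osculating x"
    then have "osculating x = UNIV" by blast
    then show False
      using osculating_in_pg_planes[OF that] by (simp add: pg_planes_def card_cart_basis)
  qed
  then show ?thesis
    using lines_in_plane_UnGamma_lines[of "UNIV :: ('a ^ 4) set" 2]
    by (simp add: on card_params card_cart_basis lines_in_plane_def)
qed

lemma lines_in_three_C_plane:
  assumes "p \<in> (three_C_planes :: ('a::{field,finite} ^ 4) set set)"
  shows "lines_in_plane UnGamma_lines p = 3 * (CARD('a) - 2)"
proof -
  have p: "vec.subspace p" "vec.dim p = 1 + 2" "card (params_on p) = 3"
    using assms by (auto simp: three_C_planes_eq pg_planes_def)
  have "\<not> p \<subseteq> osculating x" if x: "x \<in> params_on p" for x
  proof
    assume "p \<subseteq> osculating x"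
    then have "params_on p \<subseteq> {x}"
      using x osculating_iff[of x] by (auto simp: params_on_def)
    then have "card (params_on p) \<le> card {x}" by (intro card_mono) auto
    with p show False by simp
  qed
  from lines_in_plane_UnGamma_lines[OF p(1,2) this] show ?thesis by (simp add: p(3))
qed

lemma lines_in_one_C_bar_plane:
  assumes "p \<in> (one_C_bar_planes :: ('a::{field,finite} ^ 4) set set)"
  shows "lines_in_plane UnGamma_lines p = CARD('a)"
proof -
  have p: "vec.subspace p" "vec.dim p = 1 + 2" "card (params_on p) = 1" "p \<notin> Gamma_planes"
    using assms by (auto simp: one_C_bar_planes_eq pg_planes_def)
  have "\<not> p \<subseteq> osculating x" if x: "x \<in> params_on p" for x
  proof
    \<comment> \<open>Unlike for three cubic points, the number of cubic points gives no
      contradiction; equal dimensions force \<open>p = osculating x\<close>, a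
      \<Gamma>-plane.\<close>
    assume sub: "p \<subseteq> osculating x"
    have "x \<in> params" using x by (simp add: params_on_def)
    then have "osculating x \<in> pg_planes" "osculating x \<in> Gamma_planes"
      by (simp_all add: osculating_in_pg_planes Gamma_planes_eq)
    then show False
      using vec.subspace_dim_equal[OF p(1) _ sub] p(2,4) by (simp add: pg_planes_def)
  qed
  from lines_in_plane_UnGamma_lines[OF p(1,2) this] show ?thesis by (simp add: p(3))
qed

text \<open>Incident pairs of a line in \<open>L\<close> and a plane in \<open>P\<close> are counted
  from both sides.\<close>

lemma avg_planes_through_const:
  fixes P L :: "('a::{field,finite} ^ 4) set set"
  assumes "\<And>p. p \<in> P \<Longrightarrow> lines_in_plane L p = c"
  shows "avg_planes_through P L = real (card P) * real c / real (card L)"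
proof -
  have "(\<Sum>l\<in>L. planes_through_line P l) = (\<Sum>p\<in>P. lines_in_plane L p)"
    unfolding planes_through_line_def lines_in_plane_def by (rule sum_card_swap) simp_all
  also have "\<dots> = card P * c" using assms by simp
  finally show ?thesis
    unfolding avg_planes_through_def by (simp flip: of_nat_sum of_nat_mult)
qed

theorem theorem5p7:
  fixes q :: nat
  assumes "CARD('a::{field, finite}) = q" and "q \<ge> 5"
  shows "(\<forall>p \<in> (three_C_planes :: ('a ^ 4) set set).
            real (lines_in_plane UnGamma_lines p) = 3 * (real q - 2)) \<and>
         avg_planes_through (three_C_planes :: ('a ^ 4) set set) UnGamma_lines = (real q - 2) / 2 \<and>
         (\<forall>p \<in> (one_C_bar_planes :: ('a ^ 4) set set).
            real (lines_in_plane UnGamma_lines p) = real q) \<and>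
         avg_planes_through (one_C_bar_planes :: ('a ^ 4) set set) UnGamma_lines = real q / 2"
proof -
  \<comment> \<open>\<open>N\<close> is the number of Un\<Gamma>-lines, and the two plane classes
    have sizes \<open>N / 6\<close> and \<open>N / 2\<close>. It thus cancels, leaving one sixth of
    \<open>3 * (q - 2)\<close> and one half of \<open>q\<close>.\<close>
  define N where "N = (q + 1) * (q ^ 2 - q)"
  obtain r where r: "q = Suc (Suc r)" "r > 0"
    using assms(2) by (cases q; cases "q - 1") auto
  have "N > 0" using r by (simp add: N_def power2_eq_square)
  have L: "card (UnGamma_lines :: ('a ^ 4) set set) = N"
    using card_UnGamma_lines[where ?'a = 'a] assms(1) by (simp add: N_def)
  have P1: "2 * card (one_C_bar_planes :: ('a ^ 4) set set) = N"
    using card_one_C_bar_planes[where ?'a = 'a] assms(1) by (simp add: N_def)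
  have P3: "6 * card (three_C_planes :: ('a ^ 4) set set) = N"
  proof -
    have "6 * ((q + 1) choose 3) = (q + 1) * q * Suc r"
      using six_times_choose_three[of "Suc r"] r(1) by simp
    also have "\<dots> = N" by (simp add: N_def r power2_eq_square algebra_simps)
    finally show ?thesis
      using card_planes_three[where ?'a = 'a] assms(1) by (simp add: three_C_planes_eq)
  qed
  have c3: "real (card (three_C_planes :: ('a ^ 4) set set)) = real N / 6"
    and c1: "real (card (one_C_bar_planes :: ('a ^ 4) set set)) = real N / 2"
    using P1 P3 by linarith+
  \<comment> \<open>Natural and real subtraction agree here because
    \<open>q \<ge> 5\<close>.\<close>
  have q: "real (3 * (q - 2)) = 3 * (real q - 2)" using assms(2) by simp
  have "avg_planes_through (three_C_planes :: ('a ^ 4) set set) UnGamma_lines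
      = real (card (three_C_planes :: ('a ^ 4) set set)) * real (3 * (q - 2)) / real N"
    using avg_planes_through_const[OF lines_in_three_C_plane] assms(1) L by metis
  also have "\<dots> = (real q - 2) / 2"
    unfolding c3 q using \<open>N > 0\<close> by (simp add: field_simps)
  finally have avg3:
    "avg_planes_through (three_C_planes :: ('a ^ 4) set set) UnGamma_lines = (real q - 2) / 2" .
  have "avg_planes_through (one_C_bar_planes :: ('a ^ 4) set set) UnGamma_lines
      = real (card (one_C_bar_planes :: ('a ^ 4) set set)) * real q / real N"
    using avg_planes_through_const[OF lines_in_one_C_bar_plane] assms(1) L by metis
  also have "\<dots> = real q / 2"
    unfolding c1 using \<open>N > 0\<close> by simp
  finally have avg1:
    "avg_planes_through (one_C_bar_planes :: ('a ^ 4) set set) UnGamma_lines = real q / 2" .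
  have "\<forall>p \<in> (three_C_planes :: ('a ^ 4) set set).
      real (lines_in_plane UnGamma_lines p) = 3 * (real q - 2)"
    using lines_in_three_C_plane[where ?'a = 'a] unfolding assms(1) q[symmetric] by simp
  moreover have "\<forall>p \<in> (one_C_bar_planes :: ('a ^ 4) set set).
      real (lines_in_plane UnGamma_lines p) = real q"
    using lines_in_one_C_bar_plane[where ?'a = 'a] unfolding assms(1) by simp
  ultimately show ?thesis using avg3 avg1 by blast
qed

end
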